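(* Let $p\ge 2$, $V=\{1,\dots,p\}$, $\pi\in(0,1)$, and consider the tessellation prior \[ p(\mathcal T)\propto |\mathcal C(\mathcal T)|\,\binom{p}{|\mathcal T|}^{-1}\prod_{k=1}^{|\mathcal T|} f_{\mathrm{coh.}}\{p_k(\mathcal T)\}\,f_{\mathrm{sim.}}\{x_k(\mathcal T,X)\} \] on the set of tessellations $\mathcal T$ of $V$ (as defined in the context), with $f_{\mathrm{sim.}}(x_k)=1$ and $f_{\mathrm{coh.}}(p_k)=(1-\pi)^{p_k-1}\pi$. Let $K=|\mathcal T|$ be the number of supernodes. Then, under this prior: (i) the marginal distribution of $K$ satisfies $p(K)\propto\{\pi/(1-\pi)\}^K$ for $K\in\{1,\dots,p\}$; (ii) letting $E$ denote the expectation with respect to the prior and $\overline p=\sum_{k=1}^K p_k/K$ the mean supernode size, $E[\overline p]$ is a decreasing function of $\pi$, with $E[\overline p]\to p$ as $\pi\to0$ and $E[\overline p]\to1$ as $\pi\to1$.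
   Context: $X$ is a real $n\times p$ data matrix with columns $X_1,\dots,X_p$, standardized so that each column sums to $0$ and has $\|X_j\|^2=n$. The sample correlation is $\hat\rho_{ij}=X_i^\top X_j/(\|X_i\|\,\|X_j\|)$, and the distance between nodes $i,j\in V$ is $\sqrt{2(1-|\hat\rho_{ij}|)}$. For a nonempty set of centers $C\subset V$, every node $i\in V$ is assigned to the center $c\in C$ minimizing its distance to $c$ (with a fixed deterministic rule to break ties, under which each center is assigned to itself). The nodes assigned to a given center form a supernode, so $C$ deterministically determines a partition $\mathcal T=\{S_k\}_{k=1}^K$ of $V$ into $K=|\mathcal T|=|C|$ supernodes; partitions of $V$ obtained in this way are called tessellations, and they are the support of the prior. $\mathcal C(\mathcal T)$ denotes the set of all nonempty $C\subset V$ inducing the tessellation $\mathcal T$. $p_k=p_k(\mathcal T)=|S_k|$ is the size of the $k$-th supernode and $x_k=x_k(\mathcal T,X)$ is the submatrix of $X$ with columns $\{X_i\}_{i\in S_k}$. $f_{\mathrm{coh.}}$ (the cohesion function) is a function of the supernode size and $f_{\mathrm{sim.}}$ (the similarity function) is a function of $x_k$. *)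

theory Defs
  imports "HOL-Probability.Probability"
begin

text \<open>
  The data matrix is \<open>X :: real ^ 'p ^ 'n\<close> (\<open>n = CARD('n)\<close> rows, \<open>p = CARD('p)\<close> columns), and
  the node set \<open>V = {1,\<dots>,p}\<close> is the index type \<open>'p\<close> of the columns.
\<close>

definition standardized :: "real ^ 'p ^ 'n \<Rightarrow> bool" where
  "standardized X \<longleftrightarrow>
     (\<forall>j. (\<Sum>i\<in>UNIV. column j X $ i) = 0 \<and> (norm (column j X))\<^sup>2 = real CARD('n))"

definition sample_corr :: "real ^ 'p ^ 'n \<Rightarrow> 'p \<Rightarrow> 'p \<Rightarrow> real" where
  "sample_corr X i j =
     (column i X \<bullet> column j X) / (norm (column i X) * norm (column j X))"

definition node_dist :: "real ^ 'p ^ 'n \<Rightarrow> 'p \<Rightarrow> 'p \<Rightarrow> real" where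
  "node_dist X i j = sqrt (2 * (1 - \<bar>sample_corr X i j\<bar>))"

text \<open>
  \<open>a C i\<close> is the center of \<open>C\<close> to which node \<open>i\<close> is assigned. Ties may be broken in any
  deterministic way (possibly depending on \<open>C\<close> and \<open>i\<close>), provided that centers are assigned to
  themselves; a fixed tie-breaking rule is the same thing as a fixed function \<open>a\<close> of this kind.
\<close>

definition assignment_rule ::
    "real ^ 'p ^ 'n \<Rightarrow> ('p set \<Rightarrow> 'p \<Rightarrow> 'p) \<Rightarrow> bool" where
  "assignment_rule X a \<longleftrightarrow>
     (\<forall>C. C \<noteq> {} \<longrightarrow>
        (\<forall>i. is_arg_min (node_dist X i) (\<lambda>c. c \<in> C) (a C i)) \<and> (\<forall>c\<in>C. a C c = c))"

definition tessellation :: "('p set \<Rightarrow> 'p \<Rightarrow> 'p) \<Rightarrow> 'p set \<Rightarrow> 'p set set" where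
  "tessellation a C = (\<lambda>c. {i. a C i = c}) ` C"

definition tessellations :: "('p set \<Rightarrow> 'p \<Rightarrow> 'p) \<Rightarrow> 'p set set set" where
  "tessellations a = tessellation a ` {C. C \<noteq> {}}"

definition center_sets :: "('p set \<Rightarrow> 'p \<Rightarrow> 'p) \<Rightarrow> 'p set set \<Rightarrow> 'p set set" where
  "center_sets a T = {C. C \<noteq> {} \<and> tessellation a C = T}"

text \<open>
  The submatrix with columns indexed by \<open>S\<close>, as a family of columns with domain \<open>S\<close>.
\<close>

definition column_submatrix :: "real ^ 'p ^ 'n \<Rightarrow> 'p set \<Rightarrow> 'p \<rightharpoonup> real ^ 'n" where
  "column_submatrix X S = (\<lambda>j. Some (column j X)) |` S"

definition tess_weight ::
    "(nat \<Rightarrow> real) \<Rightarrow> (('p \<rightharpoonup> real ^ 'n) \<Rightarrow> real) \<Rightarrow> real ^ 'p ^ 'n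
      \<Rightarrow> ('p set \<Rightarrow> 'p \<Rightarrow> 'p) \<Rightarrow> 'p set set \<Rightarrow> real" where
  "tess_weight f_coh f_sim X a T =
     real (card (center_sets a T)) * inverse (real (CARD('p) choose card T)) *
     (\<Prod>S\<in>T. f_coh (card S) * f_sim (column_submatrix X S))"

definition tess_prior ::
    "(nat \<Rightarrow> real) \<Rightarrow> (('p \<rightharpoonup> real ^ 'n) \<Rightarrow> real) \<Rightarrow> real ^ 'p ^ 'n
      \<Rightarrow> ('p set \<Rightarrow> 'p \<Rightarrow> 'p) \<Rightarrow> 'p set set pmf" where
  "tess_prior f_coh f_sim X a = embed_pmf (\<lambda>T.
     if T \<in> tessellations a
     then tess_weight f_coh f_sim X a T /
          (\<Sum>T'\<in>tessellations a. tess_weight f_coh f_sim X a T')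
     else 0)"

definition geometric_cohesion :: "real \<Rightarrow> nat \<Rightarrow> real" where
  "geometric_cohesion \<pi> k = (1 - \<pi>) ^ (k - 1) * \<pi>"

definition geometric_tess_prior ::
    "real ^ 'p ^ 'n \<Rightarrow> ('p set \<Rightarrow> 'p \<Rightarrow> 'p) \<Rightarrow> real \<Rightarrow> 'p set set pmf" where
  "geometric_tess_prior X a \<pi> = tess_prior (geometric_cohesion \<pi>) (\<lambda>_. 1) X a"

definition mean_supernode_size :: "'p set set \<Rightarrow> real" where
  "mean_supernode_size T = (\<Sum>S\<in>T. real (card S)) / real (card T)"

definition expected_mean_size ::
    "real ^ 'p ^ 'n \<Rightarrow> ('p set \<Rightarrow> 'p \<Rightarrow> 'p) \<Rightarrow> real \<Rightarrow> real" where
  "expected_mean_size X a \<pi> =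
     measure_pmf.expectation (geometric_tess_prior X a \<pi>) mean_supernode_size"

text \<open>
  The following facts show that the definitions above are not degenerate: assignment rules exist,
  and for positive cohesion and similarity functions the prior has the intended mass function.
\<close>

lemma assignment_rule_exists:
  fixes X :: "real ^ 'p ^ 'n"
  assumes "standardized X"
  shows "\<exists>a. assignment_rule X a"
proof -
  have nz: "norm (column j X) \<noteq> 0" for j
    using assms unfolding standardized_def by (metis of_nat_0_less_iff order_less_irrefl
        power_zero_numeral zero_less_card_finite)
  have self: "node_dist X i i = 0" for i
    using nz[of i] by (simp add: node_dist_def sample_corr_def dot_square_norm power2_eq_square)
  have "\<bar>sample_corr X i j\<bar> \<le> 1" for i j
    using Cauchy_Schwarz_ineq2[of "column i X" "column j X"] nz[of i] nz[of j]
    by (simp add: sample_corr_def abs_mult divide_simps)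
  then have nonneg: "0 \<le> node_dist X i j" for i j
    by (simp add: node_dist_def)
  let ?a = "\<lambda>C i. if i \<in> C then i else arg_min_on (node_dist X i) C"
  have "is_arg_min (node_dist X i) (\<lambda>c. c \<in> C) (?a C i)" if "C \<noteq> {}" for C i
  proof (cases "i \<in> C")
    case True
    then show ?thesis using nonneg[of i] by (simp add: is_arg_min_linorder self)
  next
    case False
    then show ?thesis
      using that arg_min_if_finite[of C "node_dist X i"] by (auto simp: is_arg_min_def)
  qed
  then have "assignment_rule X ?a"
    unfolding assignment_rule_def by auto
  then show ?thesis by blast
qed

lemma pmf_tess_prior:
  fixes X :: "real ^ 'p ^ 'n" and a :: "'p set \<Rightarrow> 'p \<Rightarrow> 'p"
  assumes "\<And>k. 0 < f_coh k" "\<And>x. 0 < f_sim x"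
  shows "pmf (tess_prior f_coh f_sim X a) T =
    (if T \<in> tessellations a
     then tess_weight f_coh f_sim X a T /
          (\<Sum>T'\<in>tessellations a. tess_weight f_coh f_sim X a T')
     else 0)"
proof -
  let ?w = "tess_weight f_coh f_sim X a" and ?Z = "tessellations a"
  have pos: "0 < ?w T" if T: "T \<in> ?Z" for T
  proof -
    obtain C where C: "C \<noteq> {}" "T = tessellation a C"
      using T by (auto simp: tessellations_def)
    then have "C \<in> center_sets a T"
      by (simp add: center_sets_def)
    then have "0 < card (center_sets a T)"
      by (metis card_gt_0_iff empty_iff finite)
    moreover have "card T \<le> CARD('p)"
      unfolding C tessellation_def
      by (meson card_image_le card_mono finite order_trans top_greatest)
    then have "0 < CARD('p) choose card T"
      by simp
    moreover have "0 < (\<Prod>S\<in>T. f_coh (card S) * f_sim (column_submatrix X S))"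
      using assms by (intro prod_pos) simp
    ultimately show ?thesis
      by (simp add: tess_weight_def)
  qed
  have "?Z \<noteq> {}"
    unfolding tessellations_def by blast
  then have Z: "0 < sum ?w ?Z"
    using pos by (intro sum_pos) auto
  let ?f = "\<lambda>T. if T \<in> ?Z then ?w T / sum ?w ?Z else 0"
  have nn: "0 \<le> ?f T" for T
    using pos[of T] Z by (auto intro!: divide_nonneg_nonneg)
  have "(\<Sum>T\<in>UNIV. ?f T) = (\<Sum>T\<in>?Z. ?w T / sum ?w ?Z)"
    by (simp add: sum.If_cases)
  also have "\<dots> = 1"
    using Z by (simp flip: sum_divide_distrib)
  finally have "(\<integral>\<^sup>+T. ennreal (?f T) \<partial>count_space UNIV) = 1"
    using nn by (simp add: nn_integral_count_space_finite sum_ennreal)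
  then show ?thesis
    unfolding tess_prior_def using nn by (subst pmf_embed_pmf) auto
qed

end

theory Submission
  imports Defs
begin

text \<open>
  A center set and its tessellation have the same cardinality, so summing the prior weights
  over the tessellations with \<open>K\<close> supernodes amounts to counting the \<open>K\<close>-element center sets,
  and the factor \<open>inverse (p choose K)\<close> cancels that count. Since the supernode sizes add up to
  \<open>p\<close>, the product of cohesions is \<open>\<pi> ^ K * (1 - \<pi>) ^ (p - K)\<close>, which gives (i) and makes
  the expectation of \<open>p / K\<close> a quotient of two polynomials in \<open>\<pi>\<close>. Its limits are read off after
  cancelling one factor \<open>\<pi>\<close>, and its monotonicity follows by symmetrising a double sum, as the
  weights have a strictly monotone likelihood ratio.
\<close>

subsection \<open>Tessellations\<close>

text \<open>Each center lies in its own cell, so a cell determines its center.\<close>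

lemma inj_on_assignment_cells:
  assumes "assignment_rule X a"
  shows "inj_on (\<lambda>c. {i. a C i = c}) C"
proof (cases "C = {}")
  case False
  then have "a C c = c" if "c \<in> C" for c
    using assms that by (auto simp: assignment_rule_def)
  then show ?thesis
    by (intro inj_onI) (metis mem_Collect_eq)
qed simp

lemma card_tessellation:
  assumes "assignment_rule X a"
  shows "card (tessellation a C) = card C"
  unfolding tessellation_def using inj_on_assignment_cells[OF assms] by (rule card_image)

lemma tessellation_cell_nonempty:
  assumes "assignment_rule X a" "C \<noteq> {}" "S \<in> tessellation a C"
  shows "S \<noteq> {}"
  using assms by (auto simp: assignment_rule_def tessellation_def)

lemma sum_card_tessellation:
  fixes a :: "'p::finite set \<Rightarrow> 'p \<Rightarrow> 'p"
  assumes a: "assignment_rule X a" and C: "C \<noteq> {}"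
  shows "(\<Sum>S\<in>tessellation a C. card S) = CARD('p)"
proof -
  \<comment> \<open>The cells are the fibres of \<open>a C\<close>; they cover all nodes because its
    values stay in \<open>C\<close>.\<close>
  have in_C: "a C i \<in> C" for i
    using a C by (auto simp: assignment_rule_def is_arg_min_def)
  have "(\<Sum>S\<in>tessellation a C. card S) = (\<Sum>c\<in>C. card {i. a C i = c})"
    unfolding tessellation_def by (simp add: sum.reindex inj_on_assignment_cells[OF a])
  also have "\<dots> = card (\<Union>c\<in>C. {i. a C i = c})"
    by (subst card_UN_disjoint) auto
  also have "(\<Union>c\<in>C. {i. a C i = c}) = UNIV"
    using in_C by auto
  finally show ?thesis .
qed

lemma mean_supernode_size_eq:
  fixes a :: "'p::finite set \<Rightarrow> 'p \<Rightarrow> 'p"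
  assumes "assignment_rule X a" "T \<in> tessellations a"
  shows "mean_supernode_size T = real CARD('p) / real (card T)"
  using assms sum_card_tessellation[OF assms(1)]
  by (auto simp: mean_supernode_size_def tessellations_def simp flip: of_nat_sum)

lemma prod_geometric_cohesion:
  assumes "finite T" "\<And>S. S \<in> T \<Longrightarrow> 1 \<le> card S"
  shows "(\<Prod>S\<in>T. geometric_cohesion \<pi> (card S)) = (1 - \<pi>) ^ ((\<Sum>S\<in>T. card S) - card T) * \<pi> ^ card T"
proof -
  \<comment> \<open>Cells of size at least 1 keep the truncated subtraction exact, so the exponents
    can be added.\<close>
  have "(\<Sum>S\<in>T. card S - 1) = (\<Sum>S\<in>T. card S) - card T"
    using assms by (simp add: sum_subtractf_nat)
  then show ?thesis
    by (simp add: geometric_cohesion_def prod.distrib flip: power_sum)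
qed

lemma tess_weight_geometric:
  fixes X :: "real ^ 'p ^ 'n"
  assumes a: "assignment_rule X a" and T: "T \<in> tessellations a"
  shows "tess_weight (geometric_cohesion \<pi>) (\<lambda>_. 1) X a T =
    real (card (center_sets a T)) *
    (\<pi> ^ card T * (1 - \<pi>) ^ (CARD('p) - card T) / real (CARD('p) choose card T))"
proof -
  obtain C where C: "C \<noteq> {}" "T = tessellation a C"
    using T by (auto simp: tessellations_def)
  have "1 \<le> card S" if "S \<in> T" for S
    using tessellation_cell_nonempty[OF a C(1)] that C(2)
    by (simp add: card_gt_0_iff Suc_le_eq)
  then show ?thesis
    using sum_card_tessellation[OF a C(1)] C(2)
    by (simp add: tess_weight_def prod_geometric_cohesion divide_simps)
qed

text \<open>Double counting of nonempty center sets: the left side groups them by induced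
  tessellation, the right side by cardinality.\<close>

lemma sum_center_sets:
  fixes a :: "'p::finite set \<Rightarrow> 'p \<Rightarrow> 'p" and g :: "nat \<Rightarrow> real"
  assumes a: "assignment_rule X a"
  shows "(\<Sum>T\<in>tessellations a. real (card (center_sets a T)) * g (card T)) =
    (\<Sum>K=1..CARD('p). real (CARD('p) choose K) * g K)"
proof -
  let ?N = "{C :: 'p set. C \<noteq> {}}"
  have "(\<Sum>T\<in>tessellations a. real (card (center_sets a T)) * g (card T)) =
      (\<Sum>T\<in>tessellations a. \<Sum>C\<in>{C \<in> ?N. tessellation a C = T}. g (card C))"
    by (intro sum.cong) (auto simp: center_sets_def card_tessellation[OF a, symmetric])
  also have "\<dots> = (\<Sum>C\<in>?N. g (card C))"
    by (rule sum.group) (auto simp: tessellations_def)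
  also have "\<dots> = (\<Sum>K\<in>{1..CARD('p)}. \<Sum>C\<in>{C \<in> ?N. card C = K}. g (card C))"
    by (rule sum.group[symmetric]) (auto simp: card_gt_0_iff Suc_le_eq card_mono)
  also have "\<dots> = (\<Sum>K=1..CARD('p). real (CARD('p) choose K) * g K)"
  proof (rule sum.cong)
    fix K assume "K \<in> {1..CARD('p)}"
    then have "{C \<in> ?N. card C = K} = {C. C \<subseteq> UNIV \<and> card C = K}"
      by auto
    then have "card {C \<in> ?N. card C = K} = CARD('p) choose K"
      using n_subsets[of "UNIV :: 'p set" K] by simp
    then show "(\<Sum>C\<in>{C \<in> ?N. card C = K}. g (card C)) = real (CARD('p) choose K) * g K"
      by simp
  qed simp
  finally show ?thesis .
qed

subsection \<open>The distribution of the number of supernodes\<close>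

text \<open>
  The unnormalised mass of \<open>K\<close>, divided by \<open>\<pi>\<close> so that the total mass does not vanish at
  \<open>\<pi> = 0\<close>.
\<close>

definition size_weight :: "nat \<Rightarrow> real \<Rightarrow> nat \<Rightarrow> real" where
  "size_weight p \<pi> K = \<pi> ^ (K - 1) * (1 - \<pi>) ^ (p - K)"

lemma size_weight_pos: "0 < \<pi> \<Longrightarrow> \<pi> < 1 \<Longrightarrow> 0 < size_weight p \<pi> K"
  by (simp add: size_weight_def)

lemma sum_size_weight_pos:
  assumes "0 < \<pi>" "\<pi> < 1" "1 \<le> p"
  shows "0 < (\<Sum>K=1..p. size_weight p \<pi> K)"
  using assms by (intro sum_pos) (auto simp: size_weight_pos)

lemma size_weight_eq:
  assumes "0 < \<pi>" "\<pi> < 1" "K \<in> {1..p}"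
  shows "size_weight p \<pi> K = (1 - \<pi>) ^ p / \<pi> * (\<pi> / (1 - \<pi>)) ^ K"
proof -
  obtain k where "K = Suc k"
    using assms(3) by (cases K) auto
  with assms show ?thesis
    by (simp add: size_weight_def power_diff power_divide field_simps)
qed

text \<open>The test function \<open>h\<close> serves three purposes: constant 1 gives the
  normalising constant, an indicator gives the mass of one \<open>K\<close>, and
  \<open>p / K\<close> gives the mean supernode size.\<close>

lemma sum_tess_weight_geometric:
  fixes X :: "real ^ 'p ^ 'n" and h :: "nat \<Rightarrow> real"
  assumes a: "assignment_rule X a"
  shows "(\<Sum>T\<in>tessellations a. tess_weight (geometric_cohesion \<pi>) (\<lambda>_. 1) X a T * h (card T)) =
    \<pi> * (\<Sum>K=1..CARD('p). size_weight CARD('p) \<pi> K * h K)"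
proof -
  let ?p = "CARD('p)"
  have "(\<Sum>T\<in>tessellations a. tess_weight (geometric_cohesion \<pi>) (\<lambda>_. 1) X a T * h (card T)) =
      (\<Sum>T\<in>tessellations a. real (card (center_sets a T)) *
        (\<lambda>K. \<pi> ^ K * (1 - \<pi>) ^ (?p - K) / real (?p choose K) * h K) (card T))"
    by (intro sum.cong) (simp_all add: tess_weight_geometric[OF a])
  also have "\<dots> = (\<Sum>K=1..?p. real (?p choose K) *
        (\<pi> ^ K * (1 - \<pi>) ^ (?p - K) / real (?p choose K) * h K))"
    by (rule sum_center_sets[OF a])
  also have "\<dots> = (\<Sum>K=1..?p. \<pi> * (size_weight ?p \<pi> K * h K))"
  proof (rule sum.cong)
    fix K assume "K \<in> {1..?p}"
    \<comment> \<open>The range of \<open>K\<close> makes the binomial coefficient nonzero and lets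
      one factor \<pi> split off.\<close>
    then show "real (?p choose K) * (\<pi> ^ K * (1 - \<pi>) ^ (?p - K) / real (?p choose K) * h K) =
        \<pi> * (size_weight ?p \<pi> K * h K)"
      by (cases K) (auto simp: size_weight_def)
  qed simp
  finally show ?thesis
    by (simp add: sum_distrib_left)
qed

lemma pmf_geometric_tess_prior:
  fixes X :: "real ^ 'p ^ 'n"
  assumes a: "assignment_rule X a" and "0 < \<pi>" "\<pi> < 1"
  shows "pmf (geometric_tess_prior X a \<pi>) T =
    (if T \<in> tessellations a
     then tess_weight (geometric_cohesion \<pi>) (\<lambda>_. 1) X a T /
          (\<pi> * (\<Sum>K=1..CARD('p). size_weight CARD('p) \<pi> K))
     else 0)"
  using sum_tess_weight_geometric[OF a, of \<pi> "\<lambda>_. 1"] assms(2,3)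
  by (simp add: geometric_tess_prior_def pmf_tess_prior geometric_cohesion_def)

lemma expectation_geometric_tess_prior:
  fixes X :: "real ^ 'p ^ 'n" and h :: "nat \<Rightarrow> real"
  assumes a: "assignment_rule X a" and \<pi>: "0 < \<pi>" "\<pi> < 1"
    and f: "\<And>T. T \<in> tessellations a \<Longrightarrow> f T = h (card T)"
  shows "measure_pmf.expectation (geometric_tess_prior X a \<pi>) f =
    (\<Sum>K=1..CARD('p). size_weight CARD('p) \<pi> K * h K) /
    (\<Sum>K=1..CARD('p). size_weight CARD('p) \<pi> K)"
proof -
  let ?M = "geometric_tess_prior X a \<pi>"
  let ?Z = "\<Sum>K=1..CARD('p). size_weight CARD('p) \<pi> K"
  let ?w = "tess_weight (geometric_cohesion \<pi>) (\<lambda>_. 1) X a"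
  have "measure_pmf.expectation ?M f = (\<Sum>T\<in>tessellations a. f T * pmf ?M T)"
    by (rule integral_measure_pmf_real)
      (auto simp: set_pmf_iff pmf_geometric_tess_prior[OF a \<pi>] split: if_splits)
  also have "\<dots> = (\<Sum>T\<in>tessellations a. ?w T * h (card T)) / (\<pi> * ?Z)"
    unfolding sum_divide_distrib
    by (intro sum.cong) (simp_all add: f pmf_geometric_tess_prior[OF a \<pi>])
  finally show ?thesis
    using \<pi> by (simp add: sum_tess_weight_geometric[OF a])
qed

lemma pmf_map_card_geometric_tess_prior:
  fixes X :: "real ^ 'p ^ 'n"
  assumes a: "assignment_rule X a" and \<pi>: "0 < \<pi>" "\<pi> < 1"
  shows "pmf (map_pmf card (geometric_tess_prior X a \<pi>)) K =
    (if K \<in> {1..CARD('p)}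
     then size_weight CARD('p) \<pi> K / (\<Sum>K=1..CARD('p). size_weight CARD('p) \<pi> K) else 0)"
proof -
  let ?M = "geometric_tess_prior X a \<pi>"
  \<comment> \<open>Writing the mass as the expectation of an indicator of \<open>card T\<close>
    brings it under the previous lemma.\<close>
  have "pmf (map_pmf card ?M) K = measure_pmf.expectation (map_pmf card ?M) (indicator {K})"
    by (simp only: pmf.rep_eq integral_indicator) simp
  also have "\<dots> = measure_pmf.expectation ?M (\<lambda>T. indicator {K} (card T))"
    by (rule integral_map_pmf)
  also have "\<dots> = (\<Sum>J=1..CARD('p). size_weight CARD('p) \<pi> J * indicator {K} J) /
      (\<Sum>K=1..CARD('p). size_weight CARD('p) \<pi> K)"
    using a \<pi> by (rule expectation_geometric_tess_prior) simp
  also have "(\<Sum>J=1..CARD('p). size_weight CARD('p) \<pi> J * indicator {K} J) =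
      (if K \<in> {1..CARD('p)} then size_weight CARD('p) \<pi> K else 0)"
    by (simp add: indicator_def of_bool_def if_distrib cong: if_cong)
  finally show ?thesis
    by simp
qed

subsection \<open>The expected mean supernode size\<close>

text \<open>Unlike the prior, whose unnormalised weights all vanish at \<pi> = 0, this quotient is
  meaningful at both endpoints, so the limits become values.\<close>

definition mean_size :: "nat \<Rightarrow> real \<Rightarrow> real" where
  "mean_size p \<pi> = (\<Sum>K=1..p. size_weight p \<pi> K * (real p / real K)) / (\<Sum>K=1..p. size_weight p \<pi> K)"

lemma expected_mean_size_eq:
  fixes X :: "real ^ 'p ^ 'n"
  assumes "assignment_rule X a" "0 < \<pi>" "\<pi> < 1"
  shows "expected_mean_size X a \<pi> = mean_size CARD('p) \<pi>"
  unfolding expected_mean_size_def mean_size_def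
  using assms by (rule expectation_geometric_tess_prior) (rule mean_supernode_size_eq[OF assms(1)])

section \<open>Values and continuity at the endpoints\<close>

lemma size_weight_0: "1 \<le> K \<Longrightarrow> size_weight p 0 K = (if K = 1 then 1 else 0)"
  by (simp add: size_weight_def)

lemma size_weight_1: "K \<le> p \<Longrightarrow> size_weight p 1 K = (if K = p then 1 else 0)"
  by (simp add: size_weight_def)

text \<open>Since \<open>0 ^ 0 = 1\<close>, all weight sits on \<open>K = 1\<close> at \<pi> = 0 and
  on \<open>K = p\<close> at \<pi> = 1.\<close>

lemma
  assumes "1 \<le> p"
  shows sum_size_weight_0: "(\<Sum>K=1..p. size_weight p 0 K * h K) = h 1"
    and sum_size_weight_1: "(\<Sum>K=1..p. size_weight p 1 K * h K) = h p"
proof -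
  have "(\<Sum>K=1..p. size_weight p 0 K * h K) = (\<Sum>K=1..p. if K = 1 then h K else 0)"
    by (intro sum.cong) (simp_all add: size_weight_0)
  then show "(\<Sum>K=1..p. size_weight p 0 K * h K) = h 1"
    using assms by simp
  have "(\<Sum>K=1..p. size_weight p 1 K * h K) = (\<Sum>K=1..p. if K = p then h K else 0)"
    by (intro sum.cong) (simp_all add: size_weight_1)
  then show "(\<Sum>K=1..p. size_weight p 1 K * h K) = h p"
    using assms by simp
qed

lemma
  assumes "1 \<le> p"
  shows mean_size_0: "mean_size p 0 = real p" and mean_size_1: "mean_size p 1 = 1"
    and isCont_mean_size_0: "isCont (mean_size p) 0"
    and isCont_mean_size_1: "isCont (mean_size p) 1"
proof -
  have Z: "(\<Sum>K=1..p. size_weight p 0 K) = 1" "(\<Sum>K=1..p. size_weight p 1 K) = 1"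
    using sum_size_weight_0[OF assms, of "\<lambda>_. 1"] sum_size_weight_1[OF assms, of "\<lambda>_. 1"]
    by simp_all
  show "mean_size p 0 = real p" "mean_size p 1 = 1"
    using assms unfolding mean_size_def Z sum_size_weight_0[OF assms] sum_size_weight_1[OF assms]
    by simp_all
  \<comment> \<open>One claim covers numerator and denominator; the latter equals 1 at both
    endpoints, so the quotient is continuous there.\<close>
  have "isCont (\<lambda>\<pi>. \<Sum>K=1..p. size_weight p \<pi> K * h K) x" for h :: "nat \<Rightarrow> real" and x
    unfolding size_weight_def by (intro continuous_intros)
  from this[where h = "\<lambda>K. real p / real K"] this[where h = "\<lambda>_. 1"] show
    "isCont (mean_size p) 0" "isCont (mean_size p) 1"
    unfolding mean_size_def using Z by (auto intro!: continuous_divide)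
qed

section \<open>Strict monotonicity in \<pi>\<close>

lemma size_weight_likelihood_ratio:
  assumes "0 < x" "x < y" "y < 1" "1 \<le> j" "j < k" "k \<le> p"
  shows "size_weight p y j * size_weight p x k < size_weight p x j * size_weight p y k"
proof -
  obtain i where i: "j = Suc i"
    using assms(4) by (cases j) auto
  obtain d where d: "k = j + d" "0 < d"
    using assms(5) less_imp_add_positive by blast
  obtain q where q: "p = k + q"
    using assms(6) le_Suc_ex by blast
  \<comment> \<open>The common factor of both products; what remains is the \<open>d\<close>-th
    power of \<open>x * (1 - y)\<close> or of \<open>y * (1 - x)\<close>, with
    \<open>d = k - j\<close>.\<close>
  let ?c = "(x * y) ^ i * ((1 - x) * (1 - y)) ^ q"
  have "x * (1 - y) < y * (1 - x)"
    using assms by (simp add: algebra_simps)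
  then have "(x * (1 - y)) ^ d < (y * (1 - x)) ^ d"
    using assms d(2) by (intro power_strict_mono) auto
  moreover have "0 < ?c"
    using assms by simp
  ultimately have "?c * (x * (1 - y)) ^ d < ?c * (y * (1 - x)) ^ d"
    by (rule mult_strict_left_mono)
  moreover have "size_weight p y j * size_weight p x k = ?c * (x * (1 - y)) ^ d"
    "size_weight p x j * size_weight p y k = ?c * (y * (1 - x)) ^ d"
    by (simp_all add: size_weight_def i d(1) q power_add power_mult_distrib mult_ac)
  ultimately show ?thesis
    by simp
qed

text \<open>Averaging the double sum with its index-swapped copy pairs differences of
  \<open>h\<close> with likelihood-ratio differences, so its sign can be read off term by
  term.\<close>

lemma sum_mult_diff_symmetrised:
  fixes u v h :: "'i \<Rightarrow> real"
  shows "2 * ((\<Sum>j\<in>A. u j * h j) * (\<Sum>k\<in>A. v k) - (\<Sum>j\<in>A. v j * h j) * (\<Sum>k\<in>A. u k)) =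
    (\<Sum>j\<in>A. \<Sum>k\<in>A. (h j - h k) * (u j * v k - v j * u k))"
proof -
  let ?D = "\<Sum>j\<in>A. \<Sum>k\<in>A. h j * (u j * v k - v j * u k)"
  have "(\<Sum>j\<in>A. u j * h j) * (\<Sum>k\<in>A. v k) - (\<Sum>j\<in>A. v j * h j) * (\<Sum>k\<in>A. u k) = ?D"
    unfolding sum_product sum_subtractf[symmetric] by (simp add: algebra_simps)
  moreover have "?D = (\<Sum>j\<in>A. \<Sum>k\<in>A. h k * (u k * v j - v k * u j))"
    by (rule sum.swap)
  moreover have "(\<Sum>j\<in>A. \<Sum>k\<in>A. (h j - h k) * (u j * v k - v j * u k)) =
      ?D + (\<Sum>j\<in>A. \<Sum>k\<in>A. h k * (u k * v j - v k * u j))"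
    by (simp add: algebra_simps flip: sum.distrib)
  ultimately show ?thesis
    by simp
qed

lemma mean_size_strict_antimono:
  assumes p: "2 \<le> p" and xy: "0 < x" "x < y" "y < 1"
  shows "mean_size p y < mean_size p x"
proof -
  let ?w = "size_weight p" and ?h = "\<lambda>K. real p / real K"
  let ?t = "\<lambda>j k. (?h j - ?h k) * (?w x j * ?w y k - ?w y j * ?w x k)"
  have lt: "0 < ?t j k" if "1 \<le> j" "j < k" "k \<le> p" for j k
    using that p size_weight_likelihood_ratio[OF xy that]
    by (intro mult_pos_pos) (auto intro!: divide_strict_left_mono)
  have pos: "0 < ?t j k" if "j \<in> {1..p}" "k \<in> {1..p}" "j \<noteq> k" for j k
  proof (cases "j < k")
    case True
    then show ?thesis
      using lt that by auto
  next
    case False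
    then have "0 < ?t k j"
      using lt that by auto
    \<comment> \<open>Swapping \<open>j\<close> and \<open>k\<close> flips the sign of both factors
      of \<open>?t\<close>.\<close>
    then show ?thesis
      by (simp add: algebra_simps)
  qed
  have nonneg: "0 \<le> ?t j k" if "j \<in> {1..p}" "k \<in> {1..p}" for j k
    using pos[OF that] by (cases "j = k") auto
  have row_nonneg: "0 \<le> (\<Sum>k=1..p. ?t j k)" if "j \<in> {1..p}" for j
    using nonneg[OF that] by (rule sum_nonneg)
  \<comment> \<open>Diagonal terms vanish, so strictness comes from the pair \<open>(1, 2)\<close>,
    available because \<open>p\<close> is at least 2.\<close>
  have range: "1 \<in> {1..p}" "2 \<in> {1..p}"
    using p by auto
  have "0 < (\<Sum>k=1..p. ?t 1 k)"
    using pos[OF range] nonneg[OF range(1)] by (intro sum_pos2[OF _ range(2)]) simp_all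
  then have "0 < (\<Sum>j=1..p. \<Sum>k=1..p. ?t j k)"
    using row_nonneg by (rule sum_pos2[OF finite_atLeastAtMost range(1)])
  then have "(\<Sum>K=1..p. ?w y K * ?h K) * (\<Sum>K=1..p. ?w x K) <
      (\<Sum>K=1..p. ?w x K * ?h K) * (\<Sum>K=1..p. ?w y K)"
    unfolding sum_mult_diff_symmetrised[symmetric] by simp
  moreover have "0 < (\<Sum>K=1..p. ?w x K)" "0 < (\<Sum>K=1..p. ?w y K)"
    using p xy by (intro sum_size_weight_pos; simp)+
  ultimately show ?thesis
    unfolding mean_size_def by (simp add: divide_less_eq less_divide_eq mult.commute)
qed

theorem proposition3:
  fixes X :: "real ^ 'p ^ 'n" and a :: "'p set \<Rightarrow> 'p \<Rightarrow> 'p"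
  assumes "CARD('p) \<ge> 2"
    and "standardized X"
    and "assignment_rule X a"
  shows
    "(\<forall>\<pi>\<in>{0<..<1}.
        set_pmf (map_pmf card (geometric_tess_prior X a \<pi>)) = {1..CARD('p)} \<and>
        (\<exists>c>0. \<forall>K\<in>{1..CARD('p)}.
           pmf (map_pmf card (geometric_tess_prior X a \<pi>)) K = c * (\<pi> / (1 - \<pi>)) ^ K)) \<and>
     strict_antimono_on {0<..<1} (expected_mean_size X a) \<and>
     (expected_mean_size X a \<longlongrightarrow> real CARD('p)) (at_right 0) \<and>
     (expected_mean_size X a \<longlongrightarrow> 1) (at_left 1)"
proof (intro conjI ballI)
  let ?p = "CARD('p)"
  have p: "1 \<le> ?p"
    using assms(1) by simp
  fix \<pi> :: real
  assume "\<pi> \<in> {0<..<1}"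
  then have \<pi>: "0 < \<pi>" "\<pi> < 1"
    by auto
  let ?Z = "\<Sum>K=1..?p. size_weight ?p \<pi> K"
  have Z: "0 < ?Z"
    using \<pi> p by (rule sum_size_weight_pos)
  note pmf = pmf_map_card_geometric_tess_prior[OF assms(3) \<pi>]
  show "set_pmf (map_pmf card (geometric_tess_prior X a \<pi>)) = {1..?p}"
    unfolding set_pmf_eq pmf using Z size_weight_pos[OF \<pi>, of ?p] by (auto simp: less_le)
  show "\<exists>c>0. \<forall>K\<in>{1..?p}.
      pmf (map_pmf card (geometric_tess_prior X a \<pi>)) K = c * (\<pi> / (1 - \<pi>)) ^ K"
    \<comment> \<open>The witness is the prefactor in \<open>size_weight_eq\<close> divided by the
      total mass \<open>?Z\<close>.\<close>
    using \<pi> Z by (intro exI[of _ "(1 - \<pi>) ^ ?p / \<pi> / ?Z"]) (simp add: pmf size_weight_eq)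
next
  show "strict_antimono_on {0<..<1} (expected_mean_size X a)"
    using assms(1) by (intro monotone_onI)
      (simp add: expected_mean_size_eq[OF assms(3)] mean_size_strict_antimono)
next
  have "(mean_size CARD('p) \<longlongrightarrow> real CARD('p)) (at_right 0)"
    using isCont_mean_size_0[of "CARD('p)"] mean_size_0[of "CARD('p)"] assms(1)
    by (auto simp: isCont_def intro: filterlim_mono[OF _ order_refl at_le])
  \<comment> \<open>The closed form is established only on the open unit interval, which is enough
    for a one-sided limit.\<close>
  moreover have "\<forall>\<^sub>F \<pi> in at_right 0. mean_size CARD('p) \<pi> = expected_mean_size X a \<pi>"
    using eventually_at_right_real[OF zero_less_one]
    by eventually_elim (simp_all add: expected_mean_size_eq[OF assms(3)])
  ultimately show "(expected_mean_size X a \<longlongrightarrow> real CARD('p)) (at_right 0)"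
    by (rule Lim_transform_eventually)
next
  have "(mean_size CARD('p) \<longlongrightarrow> 1) (at_left 1)"
    using isCont_mean_size_1[of "CARD('p)"] mean_size_1[of "CARD('p)"] assms(1)
    by (auto simp: isCont_def intro: filterlim_mono[OF _ order_refl at_le])
  moreover have "\<forall>\<^sub>F \<pi> in at_left 1. mean_size CARD('p) \<pi> = expected_mean_size X a \<pi>"
    using eventually_at_left_real[OF zero_less_one]
    by eventually_elim (simp_all add: expected_mean_size_eq[OF assms(3)])
  ultimately show "(expected_mean_size X a \<longlongrightarrow> 1) (at_left 1)"
    by (rule Lim_transform_eventually)
qed

end
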